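(* Let $G=([n],E)$ be a finite simple graph. Two oriented edges of $G$ form an edge of $\mathcal{P}_G$ if and only if they are not contained in a directed $3$- or $4$-cycle of $G$.
   Context: For a finite simple graph $G=([n],E)$, the symmetric edge polytope is $\mathcal{P}_G=\mathrm{conv}(\pm(e_i-e_j) : ij\in E)\subset\mathbb{R}^n$. Its vertices are the points $e_i-e_j$ and $e_j-e_i$ with $ij\in E$, and the vertex $e_i-e_j$ is identified with the oriented edge $i\to j$. Two oriented edges $i\to j$ and $k\to\ell$ form an edge of $\mathcal{P}_G$ if the segment $\mathrm{conv}(e_i-e_j,\,e_k-e_\ell)$ is a one-dimensional face of $\mathcal{P}_G$. A directed (oriented) $m$-cycle of $G$ is a cycle of length $m$ in $G$ whose edges are all oriented consistently in one of the two cyclic directions, i.e. $v_1\to v_2\to\cdots\to v_m\to v_1$ with distinct $v_1,\dots,v_m$ and $v_sv_{s+1}\in E$ (indices mod $m$); two oriented edges are contained in it if both occur among its oriented edges.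
   Formalization: The two oriented edges are distinct, and opposite orientations of one edge are allowed only if G has no other edge: otherwise they lie on no common directed 3- or 4-cycle, yet their segment passes through 0 and is not a face (e.g. 1→2, 2→1 in the path 1-2-3). *)

theory Defs
  imports "HOL-Analysis.Analysis"
begin

text \<open>The vertex set \<open>[n]\<close> is the finite type \<^typ>\<open>'n\<close>, with \<open>n = CARD('n)\<close>, and a graph is given by
  its set of edges \<open>E\<close>, each edge being a two-element set of vertices.\<close>

definition simple_graph :: "'n::finite set set \<Rightarrow> bool" where
  "simple_graph E \<longleftrightarrow> (\<forall>e\<in>E. card e = 2)"

definition oriented_edges :: "'n::finite set set \<Rightarrow> ('n \<times> 'n) set" where
  "oriented_edges E = {(i, j). {i, j} \<in> E}"

definition edge_point :: "'n::finite \<times> 'n \<Rightarrow> real ^ 'n" where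
  "edge_point a = axis (fst a) 1 - axis (snd a) 1"

text \<open>Every edge occurs in both orientations in \<^const>\<open>oriented_edges\<close>, which accounts for the two signs
  in \<open>conv (\<plusminus>(e\<^sub>i - e\<^sub>j) : ij \<in> E)\<close>.\<close>

definition symmetric_edge_polytope :: "'n::finite set set \<Rightarrow> (real ^ 'n) set" where
  "symmetric_edge_polytope E = convex hull (edge_point ` oriented_edges E)"

definition form_polytope_edge :: "'n::finite set set \<Rightarrow> 'n \<times> 'n \<Rightarrow> 'n \<times> 'n \<Rightarrow> bool" where
  "form_polytope_edge E a b \<longleftrightarrow>
     (convex hull {edge_point a, edge_point b}) edge_of symmetric_edge_polytope E"

definition cycle_arcs :: "'n list \<Rightarrow> ('n \<times> 'n) set" where
  "cycle_arcs vs = {(vs ! s, vs ! (Suc s mod length vs)) | s. s < length vs}"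

definition directed_cycle :: "'n::finite set set \<Rightarrow> nat \<Rightarrow> 'n list \<Rightarrow> bool" where
  "directed_cycle E m vs \<longleftrightarrow>
     3 \<le> m \<and> length vs = m \<and> distinct vs \<and> cycle_arcs vs \<subseteq> oriented_edges E"

end

theory Submission
  imports Defs
begin

text \<open>
  Two distinct arcs share their tail, share their head, follow one another, are opposite, or are
  disjoint. In each of these shapes both sides of the equivalence reduce to the presence of
  particular edges in \<open>E\<close>, and these conditions are complementary.

  A short cycle destroys the polytope edge by an exchange: write \<open>p\<close> and \<open>q\<close> for the vertices of the
  two arcs. Consecutive arcs \<open>x \<rightarrow> y \<rightarrow> z\<close> give \<open>p + q = e\<^sub>x - e\<^sub>z\<close>, which is \<open>(e\<^sub>x - e\<^sub>z) + 0\<close> if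
  \<open>xz\<close> is an edge, and \<open>(e\<^sub>x - e\<^sub>w) + (e\<^sub>w - e\<^sub>z)\<close> if \<open>w\<close> is adjacent to both \<open>x\<close> and \<open>z\<close>; disjoint arcs
  \<open>x \<rightarrow> y\<close> and \<open>z \<rightarrow> w\<close> can exchange their heads if \<open>xw\<close> and \<open>zy\<close> are edges. So the midpoint of
  the segment from \<open>p\<close> to \<open>q\<close> is also the midpoint of a segment between points of the polytope that
  lie outside the first one, which a face does not permit
  (\<open>not_form_polytope_edge_if_exchange\<close>).

  In the absence of a short cycle, a linear functional is maximal on \<open>p\<close> and \<open>q\<close> only. A functional
  is a potential \<open>h\<close> on the vertices of the graph, and its value at the arc \<open>u \<rightarrow> v\<close> is the drop
  \<open>h u - h v\<close>; so it is enough to find a potential whose drop is largest exactly along the two given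
  arcs (\<open>form_polytope_edge_if_potential\<close>), and the missing edges leave room for one.
\<close>

section \<open>Short directed cycles through two arcs\<close>

lemma simple_graph_loopless:
  assumes "simple_graph E" "{x, y} \<in> E"
  shows "x \<noteq> y"
  using assms unfolding simple_graph_def by fastforce

definition in_short_cycle :: "'n::finite set set \<Rightarrow> 'n \<times> 'n \<Rightarrow> 'n \<times> 'n \<Rightarrow> bool" where
  "in_short_cycle E a b \<longleftrightarrow>
     (\<exists>m\<in>{3, 4}. \<exists>vs. directed_cycle E m vs \<and> a \<in> cycle_arcs vs \<and> b \<in> cycle_arcs vs)"

lemma cycle_arcs_3: "cycle_arcs [x, y, z] = {(x, y), (y, z), (z, x)}"
proof -
  have "{s. s < length [x, y, z]} = {0, Suc 0, Suc (Suc 0)}" by auto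
  then show ?thesis
    unfolding cycle_arcs_def setcompr_eq_image by simp
qed

lemma cycle_arcs_4: "cycle_arcs [x, y, z, w] = {(x, y), (y, z), (z, w), (w, x)}"
proof -
  have "{s. s < length [x, y, z, w]} = {0, Suc 0, Suc (Suc 0), Suc (Suc (Suc 0))}" by auto
  then show ?thesis
    unfolding cycle_arcs_def setcompr_eq_image by simp
qed

text \<open>
  With the vertices of the cycle named, the two arcs can be matched against explicit pairs, and no
  index arithmetic remains.
\<close>

lemma in_short_cycle_cases:
  "in_short_cycle E a b \<longleftrightarrow>
     (\<exists>x y z. distinct [x, y, z] \<and> {x, y} \<in> E \<and> {y, z} \<in> E \<and> {z, x} \<in> E \<and>
        {a, b} \<subseteq> {(x, y), (y, z), (z, x)}) \<or>
     (\<exists>x y z w. distinct [x, y, z, w] \<and> {x, y} \<in> E \<and> {y, z} \<in> E \<and> {z, w} \<in> E \<and> {w, x} \<in> E \<and>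
        {a, b} \<subseteq> {(x, y), (y, z), (z, w), (w, x)})"
  (is "_ \<longleftrightarrow> ?three \<or> ?four")
proof -
  have "?three \<longleftrightarrow> (\<exists>vs. directed_cycle E 3 vs \<and> a \<in> cycle_arcs vs \<and> b \<in> cycle_arcs vs)"
  proof
    assume ?three
    then obtain x y z where "distinct [x, y, z]" "{x, y} \<in> E" "{y, z} \<in> E" "{z, x} \<in> E"
        "{a, b} \<subseteq> {(x, y), (y, z), (z, x)}" by blast
    then show "\<exists>vs. directed_cycle E 3 vs \<and> a \<in> cycle_arcs vs \<and> b \<in> cycle_arcs vs"
      by (intro exI[of _ "[x, y, z]"])
        (simp add: directed_cycle_def cycle_arcs_3 oriented_edges_def)
  next
    assume "\<exists>vs. directed_cycle E 3 vs \<and> a \<in> cycle_arcs vs \<and> b \<in> cycle_arcs vs"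
    then obtain vs where vs: "directed_cycle E 3 vs" "a \<in> cycle_arcs vs" "b \<in> cycle_arcs vs"
      by blast
    then obtain x y z where "vs = [x, y, z]"
      by (auto simp: directed_cycle_def numeral_3_eq_3 length_Suc_conv)
    with vs show ?three
      by (intro exI[of _ x] exI[of _ y] exI[of _ z])
        (simp add: directed_cycle_def cycle_arcs_3 oriented_edges_def)
  qed
  moreover
  have "?four \<longleftrightarrow> (\<exists>vs. directed_cycle E 4 vs \<and> a \<in> cycle_arcs vs \<and> b \<in> cycle_arcs vs)"
  proof
    assume ?four
    then obtain x y z w where "distinct [x, y, z, w]"
        "{x, y} \<in> E" "{y, z} \<in> E" "{z, w} \<in> E" "{w, x} \<in> E"
        "{a, b} \<subseteq> {(x, y), (y, z), (z, w), (w, x)}" by blast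
    then show "\<exists>vs. directed_cycle E 4 vs \<and> a \<in> cycle_arcs vs \<and> b \<in> cycle_arcs vs"
      by (intro exI[of _ "[x, y, z, w]"])
        (simp add: directed_cycle_def cycle_arcs_4 oriented_edges_def)
  next
    assume "\<exists>vs. directed_cycle E 4 vs \<and> a \<in> cycle_arcs vs \<and> b \<in> cycle_arcs vs"
    then obtain vs where vs: "directed_cycle E 4 vs" "a \<in> cycle_arcs vs" "b \<in> cycle_arcs vs"
      by blast
    then have "length vs = Suc (Suc (Suc (Suc 0)))"
      by (simp add: directed_cycle_def)
    then obtain x y z w where "vs = [x, y, z, w]"
      by (auto simp: length_Suc_conv)
    with vs show ?four
      by (intro exI[of _ x] exI[of _ y] exI[of _ z] exI[of _ w])
        (simp add: directed_cycle_def cycle_arcs_4 oriented_edges_def)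
  qed
  ultimately show ?thesis
    unfolding in_short_cycle_def by auto
qed

lemma in_short_cycle_commute: "in_short_cycle E a b \<longleftrightarrow> in_short_cycle E b a"
  unfolding in_short_cycle_def by blast

lemma not_in_short_cycle_common_tail: "y \<noteq> z \<Longrightarrow> \<not> in_short_cycle E (x, y) (x, z)"
  unfolding in_short_cycle_cases by auto

lemma not_in_short_cycle_common_head: "x \<noteq> z \<Longrightarrow> \<not> in_short_cycle E (x, y) (z, y)"
  unfolding in_short_cycle_cases by auto

lemma not_in_short_cycle_opposite: "\<not> in_short_cycle E (x, y) (y, x)"
  unfolding in_short_cycle_cases by auto

lemma in_short_cycle_consecutive:
  assumes "simple_graph E" "{x, y} \<in> E" "{y, z} \<in> E" "x \<noteq> z"
  shows "in_short_cycle E (x, y) (y, z) \<longleftrightarrow>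
    {x, z} \<in> E \<or> (\<exists>w. w \<noteq> y \<and> {x, w} \<in> E \<and> {z, w} \<in> E)"
proof
  assume "in_short_cycle E (x, y) (y, z)"
  then show "{x, z} \<in> E \<or> (\<exists>w. w \<noteq> y \<and> {x, w} \<in> E \<and> {z, w} \<in> E)"
    unfolding in_short_cycle_cases by (auto simp: insert_commute)
next
  note loopless = simple_graph_loopless[OF assms(1)]
  assume "{x, z} \<in> E \<or> (\<exists>w. w \<noteq> y \<and> {x, w} \<in> E \<and> {z, w} \<in> E)"
  then show "in_short_cycle E (x, y) (y, z)"
  proof
    assume "{x, z} \<in> E"
    then have "distinct [x, y, z] \<and> {x, y} \<in> E \<and> {y, z} \<in> E \<and> {z, x} \<in> E \<and>
        {(x, y), (y, z)} \<subseteq> {(x, y), (y, z), (z, x)}"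
      using assms loopless by (auto simp: insert_commute)
    then show ?thesis unfolding in_short_cycle_cases by blast
  next
    assume "\<exists>w. w \<noteq> y \<and> {x, w} \<in> E \<and> {z, w} \<in> E"
    then obtain w where "w \<noteq> y" "{x, w} \<in> E" "{z, w} \<in> E" by blast
    then have "distinct [x, y, z, w] \<and> {x, y} \<in> E \<and> {y, z} \<in> E \<and> {z, w} \<in> E \<and> {w, x} \<in> E \<and>
        {(x, y), (y, z)} \<subseteq> {(x, y), (y, z), (z, w), (w, x)}"
      using assms loopless by (auto simp: insert_commute)
    then show ?thesis unfolding in_short_cycle_cases by blast
  qed
qed

lemma in_short_cycle_disjoint:
  assumes "{x, y} \<in> E" "{z, w} \<in> E" "distinct [x, y, z, w]"
  shows "in_short_cycle E (x, y) (z, w) \<longleftrightarrow> {y, z} \<in> E \<and> {w, x} \<in> E"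
proof
  assume "in_short_cycle E (x, y) (z, w)"
  then show "{y, z} \<in> E \<and> {w, x} \<in> E"
    using assms(3) unfolding in_short_cycle_cases by auto
next
  assume "{y, z} \<in> E \<and> {w, x} \<in> E"
  then have "distinct [x, y, z, w] \<and> {x, y} \<in> E \<and> {y, z} \<in> E \<and> {z, w} \<in> E \<and> {w, x} \<in> E \<and>
      {(x, y), (z, w)} \<subseteq> {(x, y), (y, z), (z, w), (w, x)}"
    using assms by auto
  then show "in_short_cycle E (x, y) (z, w)"
    unfolding in_short_cycle_cases by blast
qed

section \<open>Edges of the symmetric edge polytope\<close>

lemma edge_point_nth: "edge_point (x, y) $ k = of_bool (k = x) - of_bool (k = y)"
  by (simp add: edge_point_def axis_def)

lemma edge_point_inj:
  assumes "edge_point (x, y) = edge_point (z, w)" "x \<noteq> y" "z \<noteq> w"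
  shows "(x, y) = (z, w)"
proof -
  have "edge_point (x, y) $ x = edge_point (z, w) $ x"
    and "edge_point (x, y) $ y = edge_point (z, w) $ y"
    using assms(1) by simp_all
  then show ?thesis
    using assms(2,3) by (auto simp: edge_point_nth of_bool_def split: if_splits)
qed

lemma edge_point_in_polytope:
  "{x, y} \<in> E \<Longrightarrow> edge_point (x, y) \<in> symmetric_edge_polytope E"
  unfolding symmetric_edge_polytope_def oriented_edges_def
  by (intro hull_inc) auto

lemma form_polytope_edge_commute: "form_polytope_edge E a b \<longleftrightarrow> form_polytope_edge E b a"
  unfolding form_polytope_edge_def by (simp add: insert_commute)

text \<open>
  The level hyperplane of the potential at \<open>c\<close> contains the line through the vertices of the two arcs,
  while the hull of all other vertices lies strictly below it. As the line and the hull are disjoint,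
  the segment is a face.
\<close>

lemma form_polytope_edge_if_potential:
  fixes h :: "'n::finite \<Rightarrow> real"
  assumes G: "simple_graph E" and a: "{x, y} \<in> E" and b: "{z, w} \<in> E"
    and ne: "(x, y) \<noteq> (z, w)"
    and eq: "h x - h y = c" "h z - h w = c"
    and less: "\<And>u v. {u, v} \<in> E \<Longrightarrow> (u, v) \<noteq> (x, y) \<Longrightarrow> (u, v) \<noteq> (z, w) \<Longrightarrow> h u - h v < c"
  shows "form_polytope_edge E (x, y) (z, w)"
proof -
  define f where "f = (\<chi> i. h i)"
  have f: "f \<bullet> edge_point (u, v) = h u - h v" for u v
    by (simp add: f_def edge_point_def inner_diff_right inner_axis)
  let ?S = "edge_point ` oriented_edges E" and ?T = "{edge_point (x, y), edge_point (z, w)}"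
  have "affine {p. f \<bullet> p = c}"
    by (rule affine_hyperplane)
  then have aff: "affine hull ?T \<subseteq> {p. f \<bullet> p = c}"
    by (intro hull_minimal) (auto simp: f eq)
  have "f \<bullet> p < c" if p: "p \<in> ?S - ?T" for p
  proof -
    obtain u v where uv: "p = edge_point (u, v)" "{u, v} \<in> E"
      using p unfolding oriented_edges_def by blast
    with p have "(u, v) \<noteq> (x, y)" "(u, v) \<noteq> (z, w)"
      by blast+
    with uv less show ?thesis by (simp add: f)
  qed
  then have "convex hull (?S - ?T) \<subseteq> {p. f \<bullet> p < c}"
    by (intro hull_minimal convex_halfspace_lt) auto
  with aff have "affine hull ?T \<inter> convex hull (?S - ?T) = {}"
    by fastforce
  then have "convex hull ?T face_of convex hull ?S"
    using a b by (intro face_of_convex_hulls) (auto simp: oriented_edges_def)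
  moreover have "aff_dim (convex hull ?T) = 1"
  proof -
    have "edge_point (x, y) \<noteq> edge_point (z, w)"
      using edge_point_inj ne simple_graph_loopless[OF G] a b by metis
    then show ?thesis by (simp add: aff_dim_convex_hull aff_dim_2)
  qed
  ultimately show ?thesis
    unfolding form_polytope_edge_def symmetric_edge_polytope_def edge_of_def by simp
qed

text \<open>
  The midpoint of a face that is a segment cannot be the midpoint of a segment of the polytope that
  leaves the face.
\<close>

lemma not_form_polytope_edge_if_exchange:
  assumes r: "r \<in> symmetric_edge_polytope E" and s: "s \<in> symmetric_edge_polytope E"
    and sum: "edge_point a + edge_point b = r + s"
    and r_notin: "r \<notin> closed_segment (edge_point a) (edge_point b)"
  shows "\<not> form_polytope_edge E a b"
proof
  let ?F = "closed_segment (edge_point a) (edge_point b)"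
  let ?m = "midpoint (edge_point a) (edge_point b)"
  assume "form_polytope_edge E a b"
  then have face: "?F face_of symmetric_edge_polytope E"
    unfolding form_polytope_edge_def edge_of_def segment_convex_hull by simp
  have m: "?m = midpoint r s"
    using sum by (simp add: midpoint_def)
  have "?m \<in> ?F" by simp
  moreover from this r_notin m have "r \<noteq> s"
    by auto
  with m have "?m \<in> open_segment r s" by simp
  ultimately have "r \<in> ?F"
    using face r s unfolding face_of_def by blast
  with r_notin show False by simp
qed

lemma form_polytope_edge_common_tail:
  assumes "simple_graph E" "{x, y} \<in> E" "{x, z} \<in> E" "y \<noteq> z"
  shows "form_polytope_edge E (x, y) (x, z)"
proof (rule form_polytope_edge_if_potential[where c = 2 and
      h = "\<lambda>v. if v = x then 1 else if v = y \<or> v = z then -1 else 0"])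
qed (use assms simple_graph_loopless[OF assms(1)] in auto)

lemma form_polytope_edge_common_head:
  assumes "simple_graph E" "{x, y} \<in> E" "{z, y} \<in> E" "x \<noteq> z"
  shows "form_polytope_edge E (x, y) (z, y)"
proof (rule form_polytope_edge_if_potential[where c = 2 and
      h = "\<lambda>v. if v = y then -1 else if v = x \<or> v = z then 1 else 0"])
qed (use assms simple_graph_loopless[OF assms(1)] in auto)

text \<open>With a single edge the polytope is itself a segment, and the zero potential exposes all of it.\<close>

lemma form_polytope_edge_opposite:
  assumes "simple_graph E" "E = {{x, y}}"
  shows "form_polytope_edge E (x, y) (y, x)"
proof -
  have edges: "{x, y} \<in> E" "{y, x} \<in> E"
    by (simp_all add: assms(2) insert_commute)
  then have "x \<noteq> y" using simple_graph_loopless[OF assms(1)] by blast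
  show ?thesis
  proof (rule form_polytope_edge_if_potential[where c = 0 and h = "\<lambda>v. 0"])
    show "(0::real) - 0 < 0"
      if "{u, v} \<in> E" "(u, v) \<noteq> (x, y)" "(u, v) \<noteq> (y, x)" for u v
      using that unfolding assms(2) by (simp add: doubleton_eq_iff) blast
  qed (use assms(1) edges \<open>x \<noteq> y\<close> in simp_all)
qed

text \<open>
  Going down from 3 over 0 to -3 along \<open>x \<rightarrow> y \<rightarrow> z\<close>, every other neighbour of \<open>x\<close> must lie above 0
  and every other neighbour of \<open>z\<close> below 0. This is possible since no vertex but \<open>y\<close> is adjacent to
  both. The values 1 and -1 also keep the drop between two further vertices below 3.
\<close>

lemma form_polytope_edge_consecutive:
  assumes G: "simple_graph E" and xy: "{x, y} \<in> E" and yz: "{y, z} \<in> E" and xz: "x \<noteq> z"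
  shows "form_polytope_edge E (x, y) (y, z) \<longleftrightarrow>
    \<not> ({x, z} \<in> E \<or> (\<exists>w. w \<noteq> y \<and> {x, w} \<in> E \<and> {z, w} \<in> E))"
proof (intro iffI notI)
  note loopless = simple_graph_loopless[OF G]
  have ne: "x \<noteq> y" "y \<noteq> z" using loopless xy yz by auto
  assume edge: "form_polytope_edge E (x, y) (y, z)"
    and "{x, z} \<in> E \<or> (\<exists>w. w \<noteq> y \<and> {x, w} \<in> E \<and> {z, w} \<in> E)"
  then consider "{x, z} \<in> E" | w where "w \<noteq> y" "{x, w} \<in> E" "{z, w} \<in> E" by blast
  then show False
  proof cases
    case 1
    have rev: "{z, x} \<in> E" using 1 by (simp add: insert_commute)
    \<comment> \<open>The origin is the centre of the polytope, and it takes the part of the second exchanged vertex.\<close>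
    have "midpoint (edge_point (x, z)) (edge_point (z, x)) \<in> symmetric_edge_polytope E"
      using edge_point_in_polytope[OF 1] edge_point_in_polytope[OF rev]
      unfolding symmetric_edge_polytope_def
      by (metis convex_contains_segment convex_convex_hull midpoint_in_closed_segment subsetD)
    then have zero: "0 \<in> symmetric_edge_polytope E"
      by (simp add: edge_point_def midpoint_def)
    have "edge_point (x, z) \<notin> closed_segment (edge_point (x, y)) (edge_point (y, z))"
    proof
      assume "edge_point (x, z) \<in> closed_segment (edge_point (x, y)) (edge_point (y, z))"
      then obtain u where u: "edge_point (x, z) = (1 - u) *\<^sub>R edge_point (x, y) + u *\<^sub>R edge_point (y, z)"
        unfolding in_segment by blast
      show False
        using arg_cong[OF u, of "\<lambda>p. p $ x"] arg_cong[OF u, of "\<lambda>p. p $ z"] ne xz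
        by (simp add: edge_point_nth)
    qed
    then show False
      using not_form_polytope_edge_if_exchange[OF edge_point_in_polytope[OF 1] zero] edge
      by (simp add: edge_point_def)
  next
    case (2 w)
    have wz: "{w, z} \<in> E" using 2(3) by (simp add: insert_commute)
    have wne: "w \<noteq> x" "w \<noteq> z" using loopless 2 by auto
    have "edge_point (x, w) \<notin> closed_segment (edge_point (x, y)) (edge_point (y, z))"
    proof
      assume "edge_point (x, w) \<in> closed_segment (edge_point (x, y)) (edge_point (y, z))"
      then obtain u where u: "edge_point (x, w) = (1 - u) *\<^sub>R edge_point (x, y) + u *\<^sub>R edge_point (y, z)"
        unfolding in_segment by blast
      show False
        using arg_cong[OF u, of "\<lambda>p. p $ w"] 2(1) wne
        by (simp add: edge_point_nth)
    qed
    then show False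
      using not_form_polytope_edge_if_exchange[OF edge_point_in_polytope[OF 2(2)] edge_point_in_polytope[OF wz]] edge
      by (simp add: edge_point_def)
  qed
next
  note loopless = simple_graph_loopless[OF G]
  have ne: "x \<noteq> y" "y \<noteq> z" using loopless xy yz by auto
  assume none: "\<not> ({x, z} \<in> E \<or> (\<exists>w. w \<noteq> y \<and> {x, w} \<in> E \<and> {z, w} \<in> E))"
  show "form_polytope_edge E (x, y) (y, z)"
  proof (rule form_polytope_edge_if_potential[where c = 3 and
        h = "\<lambda>v. if v = x then 3 else if v = y then 0 else if v = z then -3
                 else if {x, v} \<in> E then 1 else -1"])
  qed (use G xy yz xz ne none in \<open>auto simp: insert_commute\<close>)
qed

text \<open>
  With potential 2 at both tails and -2 at both heads, the arcs \<open>x \<rightarrow> w\<close> and \<open>z \<rightarrow> y\<close> would tie with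
  the two given ones. Raising \<open>z\<close> and \<open>w\<close> by 1 keeps the drop along \<open>z \<rightarrow> w\<close> and lowers the one
  along \<open>x \<rightarrow> w\<close>; only \<open>z \<rightarrow> y\<close> gets a larger drop, and it is not an arc.
\<close>

lemma form_polytope_edge_disjoint_if_chord_missing:
  assumes G: "simple_graph E" and xy: "{x, y} \<in> E" and zw: "{z, w} \<in> E"
    and ne: "distinct [x, y, z, w]" and chord: "{y, z} \<notin> E"
  shows "form_polytope_edge E (x, y) (z, w)"
proof (rule form_polytope_edge_if_potential[where c = 4 and
      h = "\<lambda>v. if v = x then 2 else if v = y then -2 else if v = z then 3
               else if v = w then -1 else 0"])
qed (use assms in \<open>auto simp: insert_commute\<close>)

lemma form_polytope_edge_disjoint:
  assumes G: "simple_graph E" and xy: "{x, y} \<in> E" and zw: "{z, w} \<in> E"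
    and ne: "distinct [x, y, z, w]"
  shows "form_polytope_edge E (x, y) (z, w) \<longleftrightarrow> \<not> ({y, z} \<in> E \<and> {w, x} \<in> E)"
proof (intro iffI notI)
  assume edge: "form_polytope_edge E (x, y) (z, w)" and "{y, z} \<in> E \<and> {w, x} \<in> E"
  then have chords: "{x, w} \<in> E" "{z, y} \<in> E" by (simp_all add: insert_commute)
  have "edge_point (x, w) \<notin> closed_segment (edge_point (x, y)) (edge_point (z, w))"
  proof
    assume "edge_point (x, w) \<in> closed_segment (edge_point (x, y)) (edge_point (z, w))"
    then obtain u where u: "edge_point (x, w) = (1 - u) *\<^sub>R edge_point (x, y) + u *\<^sub>R edge_point (z, w)"
      unfolding in_segment by blast
    show False
      using arg_cong[OF u, of "\<lambda>p. p $ x"] arg_cong[OF u, of "\<lambda>p. p $ y"] ne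
      by (simp add: edge_point_nth)
  qed
  then show False
    using not_form_polytope_edge_if_exchange[OF edge_point_in_polytope[OF chords(1)]
        edge_point_in_polytope[OF chords(2)]] edge
    by (simp add: edge_point_def)
next
  assume "\<not> ({y, z} \<in> E \<and> {w, x} \<in> E)"
  then consider "{y, z} \<notin> E" | "{w, x} \<notin> E" by blast
  then show "form_polytope_edge E (x, y) (z, w)"
  proof cases
    case 1
    then show ?thesis
      using form_polytope_edge_disjoint_if_chord_missing assms by blast
  next
    case 2
    have "distinct [z, w, x, y]" using ne by auto
    then show ?thesis
      using form_polytope_edge_disjoint_if_chord_missing[OF G zw xy _ 2]
        form_polytope_edge_commute by blast
  qed
qed

section \<open>The characterisation\<close>

theorem theorem2p2:
  fixes E :: "'n::finite set set" and a b :: "'n \<times> 'n"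
  assumes "simple_graph E"
    and "a \<in> oriented_edges E" and "b \<in> oriented_edges E"
    and "a \<noteq> b"
    and "b = prod.swap a \<longrightarrow> E = {{fst a, snd a}}"
  shows "form_polytope_edge E a b \<longleftrightarrow>
    \<not> (\<exists>m\<in>{3, 4}. \<exists>vs. directed_cycle E m vs \<and> a \<in> cycle_arcs vs \<and> b \<in> cycle_arcs vs)"
proof -
  note G = assms(1)
  obtain x y z w where ab: "a = (x, y)" "b = (z, w)" by fastforce
  have xy: "{x, y} \<in> E" and zw: "{z, w} \<in> E"
    using assms(2,3) by (auto simp: ab oriented_edges_def)
  have ne: "x \<noteq> y" "z \<noteq> w" using simple_graph_loopless[OF G] xy zw by auto
  consider "x = z" "y \<noteq> w" | "y = w" "x \<noteq> z" | "y = z" "x = w"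
    | "y = z" "x \<noteq> w" | "w = x" "z \<noteq> y" | "distinct [x, y, z, w]"
    using assms(4) ne by (auto simp: ab)
  then have "form_polytope_edge E a b \<longleftrightarrow> \<not> in_short_cycle E a b"
  proof cases
    case 1
    then show ?thesis
      using form_polytope_edge_common_tail[OF G] not_in_short_cycle_common_tail xy zw
      by (simp add: ab)
  next
    case 2
    then show ?thesis
      using form_polytope_edge_common_head[OF G] not_in_short_cycle_common_head xy zw
      by (simp add: ab)
  next
    case 3
    then have "E = {{x, y}}" using assms(5) by (simp add: ab)
    then show ?thesis
      using form_polytope_edge_opposite[OF G] not_in_short_cycle_opposite 3 by (simp add: ab)
  next
    case 4
    then show ?thesis
      using form_polytope_edge_consecutive[OF G] in_short_cycle_consecutive[OF G] xy zw
      by (simp add: ab)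
  next
    case 5
    then have "form_polytope_edge E b a \<longleftrightarrow> \<not> in_short_cycle E b a"
      using form_polytope_edge_consecutive[OF G] in_short_cycle_consecutive[OF G] xy zw
      by (simp add: ab)
    then show ?thesis
      using form_polytope_edge_commute in_short_cycle_commute by metis
  next
    case 6
    then show ?thesis
      using form_polytope_edge_disjoint[OF G xy zw] in_short_cycle_disjoint[OF xy zw]
      by (simp add: ab)
  qed
  then show ?thesis unfolding in_short_cycle_def .
qed

end
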